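(* Let $p(\mathbf{y},\boldsymbol{\theta}) = p(\boldsymbol{\theta})\,p(\mathbf{y}\mid\boldsymbol{\theta})$ be a Bayesian model with prior $p(\boldsymbol{\theta})$, sampling distribution $p(\mathbf{y}\mid\boldsymbol{\theta})$, prior predictive (marginal) distribution $p(\mathbf{y})$, and posterior predictive distribution $p(\mathbf{y}_{\mathrm{rep}}\mid\mathbf{y})$. Let $\mathcal{T}=\{T_1,\ldots,T_d\}$ be a finite collection of real-valued (measurable) test statistics on the data space, and let $$\mathsf{joint\text{-}}p_{\mathcal{T}}(\mathbf{y}) = \mathbb{P}_{p(\mathbf{y}_{\mathrm{rep}}\mid\mathbf{y})}\left[T_1(\mathbf{y}_{\mathrm{rep}})>T_1(\mathbf{y}) \text{ and } T_2(\mathbf{y}_{\mathrm{rep}})>T_2(\mathbf{y}) \text{ and } \cdots\ T_d(\mathbf{y}_{\mathrm{rep}})>T_d(\mathbf{y})\right].$$ Let $F$ be the cumulative distribution function of the random variable $$\mathbb{P}_{p(\mathbf{y}_{\mathrm{rep}}\mid\boldsymbol{\theta})}\left[T_1(\mathbf{y}_{\mathrm{rep}})>T_1(\mathbf{y}) \text{ and } T_2(\mathbf{y}_{\mathrm{rep}})>T_2(\mathbf{y}) \text{ and } \cdots\ T_d(\mathbf{y}_{\mathrm{rep}})>T_d(\mathbf{y})\right],$$ a function of $(\mathbf{y},\boldsymbol{\theta})$, where $(\mathbf{y},\boldsymbol{\theta})\sim p(\mathbf{y},\boldsymbol{\theta})$. Then for any level $\alpha\in[0,1]$, $$\mathbb{P}_{p(\mathbf{y})}\left(\mathsf{joint\text{-}}p_{\mathcal{T}}(\mathbf{y})\leq\alpha\right)\leq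 \inf_{s\in(\alpha,1]}\frac{\int_0^s F(t)\,dt}{s-\alpha},$$ where the infimum over the empty set (the case $\alpha=1$) is $+\infty$.
   Context: The parameter $\boldsymbol{\theta}$ and the data $\mathbf{y}$ take values in spaces on which regular conditional distributions exist (e.g. Euclidean spaces). The prior predictive distribution is $p(\mathbf{y})=\int p(\mathbf{y}\mid\boldsymbol{\theta})p(\boldsymbol{\theta})\,d\boldsymbol{\theta}$, i.e. the marginal of $\mathbf{y}$ under $p(\mathbf{y},\boldsymbol{\theta})$. The posterior $p(\boldsymbol{\theta}\mid\mathbf{y})$ is the conditional distribution of $\boldsymbol{\theta}$ given $\mathbf{y}$ under $p(\mathbf{y},\boldsymbol{\theta})$. The posterior predictive distribution of a replicated data set $\mathbf{y}_{\mathrm{rep}}$ is $$p(\mathbf{y}_{\mathrm{rep}}\mid\mathbf{y})=\int p(\mathbf{y}_{\mathrm{rep}}\mid\boldsymbol{\theta})\,p(\boldsymbol{\theta}\mid\mathbf{y})\,d\boldsymbol{\theta},$$ where $p(\mathbf{y}_{\mathrm{rep}}\mid\boldsymbol{\theta})$ denotes the sampling distribution $p(\cdot\mid\boldsymbol{\theta})$ evaluated for the replicate; that is, given $\boldsymbol{\theta}$, $\mathbf{y}_{\mathrm{rep}}$ has the same sampling distribution as $\mathbf{y}$ and is conditionally independent of $\mathbf{y}$. The notation $\mathbb{P}_{q}$ means probability when the random quantity being drawn has distribution $q$, with everything else (the conditioning variables $\mathbf{y}$, or $\mathbf{y}$ and $\boldsymbol{\theta}$) held fixed. *)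

theory Defs
  imports "HOL-Probability.Probability"
begin

text \<open>
  A Bayesian model is given by measurable spaces \<open>\<Theta>\<close> (parameters) and \<open>Y\<close> (data), a prior
  \<open>prior \<in> space (prob_algebra \<Theta>)\<close> and a sampling distribution, i.e. a Markov kernel
  \<open>lik \<in> \<Theta> \<rightarrow>\<^sub>M prob_algebra Y\<close>.  Only the measurable structure of \<open>\<Theta>\<close> and \<open>Y\<close> is used;
  densities are not required.
\<close>

definition joint_dist ::
    "'t measure \<Rightarrow> 'y measure \<Rightarrow> 't measure \<Rightarrow> ('t \<Rightarrow> 'y measure) \<Rightarrow> ('y \<times> 't) measure" where
  "joint_dist \<Theta> Y prior lik = prior \<bind> (\<lambda>\<theta>. distr (lik \<theta>) (Y \<Otimes>\<^sub>M \<Theta>) (\<lambda>y. (y, \<theta>)))"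

definition prior_predictive :: "'t measure \<Rightarrow> ('t \<Rightarrow> 'y measure) \<Rightarrow> 'y measure" where
  "prior_predictive prior lik = prior \<bind> lik"

text \<open>
  \<open>post\<close> is a version of the regular conditional distribution of \<open>\<theta>\<close> given \<open>y\<close> under the joint
  distribution.  Such a kernel is unique only up to null sets of the prior predictive distribution,
  so the posterior is a predicate rather than a function of the model.
\<close>

definition is_posterior ::
    "'t measure \<Rightarrow> 'y measure \<Rightarrow> 't measure \<Rightarrow> ('t \<Rightarrow> 'y measure) \<Rightarrow> ('y \<Rightarrow> 't measure) \<Rightarrow> bool" where
  "is_posterior \<Theta> Y prior lik post \<longleftrightarrow>
     post \<in> Y \<rightarrow>\<^sub>M prob_algebra \<Theta> \<and>
     (\<forall>A\<in>sets Y. \<forall>B\<in>sets \<Theta>.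
        emeasure (joint_dist \<Theta> Y prior lik) (A \<times> B) =
        (\<integral>\<^sup>+y\<in>A. emeasure (post y) B \<partial>prior_predictive prior lik))"

definition posterior_predictive ::
    "('t \<Rightarrow> 'y measure) \<Rightarrow> ('y \<Rightarrow> 't measure) \<Rightarrow> 'y \<Rightarrow> 'y measure" where
  "posterior_predictive lik post y = post y \<bind> lik"

text \<open>
  The probability, for a replicate drawn from \<open>Q\<close> and fixed \<open>y\<close>, that all statistics
  \<open>T 1, \<dots>, T d\<close> strictly exceed their values at \<open>y\<close>.
\<close>

definition exceed_prob :: "nat \<Rightarrow> (nat \<Rightarrow> 'y \<Rightarrow> real) \<Rightarrow> 'y measure \<Rightarrow> 'y \<Rightarrow> real" where
  "exceed_prob d T Q y = measure Q {yrep \<in> space Q. \<forall>i\<in>{1..d}. T i yrep > T i y}"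

definition joint_p ::
    "nat \<Rightarrow> (nat \<Rightarrow> 'y \<Rightarrow> real) \<Rightarrow> ('t \<Rightarrow> 'y measure) \<Rightarrow> ('y \<Rightarrow> 't measure) \<Rightarrow> 'y \<Rightarrow> real" where
  "joint_p d T lik post y = exceed_prob d T (posterior_predictive lik post y) y"

definition exceed_cdf ::
    "'t measure \<Rightarrow> 'y measure \<Rightarrow> 't measure \<Rightarrow> ('t \<Rightarrow> 'y measure) \<Rightarrow>
     nat \<Rightarrow> (nat \<Rightarrow> 'y \<Rightarrow> real) \<Rightarrow> real \<Rightarrow> real" where
  "exceed_cdf \<Theta> Y prior lik d T =
     cdf (distr (joint_dist \<Theta> Y prior lik) borel (\<lambda>(y, \<theta>). exceed_prob d T (lik \<theta>) y))"

lemma prior_predictive_eq_marginal: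
  assumes prior: "prior \<in> space (prob_algebra \<Theta>)"
    and lik: "lik \<in> \<Theta> \<rightarrow>\<^sub>M prob_algebra Y"
  shows "distr (joint_dist \<Theta> Y prior lik) Y fst = prior_predictive prior lik"
proof -
  have sets [measurable_cong]: "sets prior = sets \<Theta>" and "prob_space prior"
    using prior by (auto simp: space_prob_algebra)
  then have ne: "space prior \<noteq> {}"
    using prob_space.not_empty by blast
  have [measurable]: "lik \<in> \<Theta> \<rightarrow>\<^sub>M subprob_algebra Y"
    using lik by (rule measurable_prob_algebraD)
  have k: "(\<lambda>\<theta>. distr (lik \<theta>) (Y \<Otimes>\<^sub>M \<Theta>) (\<lambda>y. (y, \<theta>))) \<in> prior \<rightarrow>\<^sub>M subprob_algebra (Y \<Otimes>\<^sub>M \<Theta>)"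
    by (rule measurable_distr2[where M = Y]) measurable
  have "distr (joint_dist \<Theta> Y prior lik) Y fst =
      prior \<bind> (\<lambda>\<theta>. distr (distr (lik \<theta>) (Y \<Otimes>\<^sub>M \<Theta>) (\<lambda>y. (y, \<theta>))) Y fst)"
    unfolding joint_dist_def by (rule distr_bind[OF k ne]) measurable
  also have "\<dots> = prior \<bind> lik"
  proof (rule bind_cong_simp[OF refl], unfold simp_implies_def)
    fix \<theta> assume "\<theta> \<in> space prior"
    then have t: "\<theta> \<in> space \<Theta>" using sets_eq_imp_space_eq[OF sets] by simp
    have s [measurable_cong]: "sets (lik \<theta>) = sets Y"
      using measurable_space[OF lik t] by (auto simp: space_prob_algebra)
    show "distr (distr (lik \<theta>) (Y \<Otimes>\<^sub>M \<Theta>) (\<lambda>y. (y, \<theta>))) Y fst = lik \<theta>"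
      using t s by (subst distr_distr) (auto simp: comp_def intro!: distr_id2)
  qed
  finally show ?thesis by (simp add: prior_predictive_def)
qed

end

theory Submission
  imports Defs
begin

text \<open>
  Write \<open>g (y, \<theta>)\<close> for the exceedance probability of a replicate drawn from \<open>lik \<theta>\<close>.  Then
  \<open>joint_p y\<close> is the posterior mean of \<open>g (y, \<cdot>)\<close>, so by Jensen's inequality for the convex function
  \<open>\<lambda>x. (s - x)\<^sup>+\<close> the posterior mean \<open>u y\<close> of \<open>(s - g (y, \<cdot>))\<^sup>+\<close> is at least \<open>s - \<alpha>\<close> whenever
  \<open>joint_p y \<le> \<alpha>\<close>.  Markov's inequality for \<open>u\<close> bounds the probability of that event by
  \<open>E (s - g)\<^sup>+ / (s - \<alpha>)\<close>, and the layer-cake formula turns \<open>E (s - g)\<^sup>+\<close> into \<open>\<integral>\<^sub>0\<^sup>s F\<close>.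
\<close>

lemma sets_exceed:
  fixes d :: nat and T :: "nat \<Rightarrow> 'y \<Rightarrow> real" and c :: "nat \<Rightarrow> real"
  assumes "\<And>i. i \<in> {1..d} \<Longrightarrow> T i \<in> borel_measurable Y"
  shows "{yrep \<in> space Y. \<forall>i\<in>{1..d}. T i yrep > c i} \<in> sets Y"
proof (rule sets.sets_Collect_finite_All)
  show "{yrep \<in> space Y. T i yrep > c i} \<in> sets Y" if "i \<in> {1..d}" for i
    using assms[OF that] by measurable
qed simp

text \<open>The event is the section at (y, \<theta>) of a measurable set of triples ((y, \<theta>),
  yrep), and the mass that a measurable kernel gives to such sections depends measurably on the base
  point.\<close>

lemma measurable_exceed_prob:
  assumes lik: "lik \<in> \<Theta> \<rightarrow>\<^sub>M prob_algebra Y"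
    and T: "\<And>i. i \<in> {1..d} \<Longrightarrow> T i \<in> borel_measurable Y"
  shows "(\<lambda>(y, \<theta>). exceed_prob d T (lik \<theta>) y) \<in> borel_measurable (Y \<Otimes>\<^sub>M \<Theta>)"
proof -
  let ?A = "\<lambda>p. {yrep \<in> space Y. \<forall>i\<in>{1..d}. T i yrep > T i (fst p)}"
  have [measurable]: "lik \<in> \<Theta> \<rightarrow>\<^sub>M subprob_algebra Y"
    using lik by (rule measurable_prob_algebraD)
  have "{q \<in> space ((Y \<Otimes>\<^sub>M \<Theta>) \<Otimes>\<^sub>M Y). \<forall>i\<in>{1..d}. T i (snd q) > T i (fst (fst q))}
      \<in> sets ((Y \<Otimes>\<^sub>M \<Theta>) \<Otimes>\<^sub>M Y)"
  proof (rule sets.sets_Collect_finite_All)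
    fix i assume "i \<in> {1..d}"
    note [measurable] = T[OF this]
    show "{q \<in> space ((Y \<Otimes>\<^sub>M \<Theta>) \<Otimes>\<^sub>M Y). T i (snd q) > T i (fst (fst q))}
      \<in> sets ((Y \<Otimes>\<^sub>M \<Theta>) \<Otimes>\<^sub>M Y)"
      by measurable
  qed simp
  also have "{q \<in> space ((Y \<Otimes>\<^sub>M \<Theta>) \<Otimes>\<^sub>M Y). \<forall>i\<in>{1..d}. T i (snd q) > T i (fst (fst q))}
      = (SIGMA p:space (Y \<Otimes>\<^sub>M \<Theta>). ?A p)"
    by (auto simp: space_pair_measure)
  finally have "(\<lambda>p. measure (lik (snd p)) (?A p)) \<in> borel_measurable (Y \<Otimes>\<^sub>M \<Theta>)"
    by (rule measure_measurable_subprob_algebra2) measurable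
  \<comment> \<open>\<open>exceed_prob\<close> collects replicates in the space of
    \<open>lik \<theta>\<close>, which is known to be \<open>space Y\<close> for \<theta> in
    \<open>space \<Theta>\<close>; hence the congruence over the product space.\<close>
  also have "?this \<longleftrightarrow> ?thesis"
  proof (rule measurable_cong)
    fix p assume "p \<in> space (Y \<Otimes>\<^sub>M \<Theta>)"
    then have "lik (snd p) \<in> space (prob_algebra Y)"
      using measurable_space[OF lik] by (auto simp: space_pair_measure)
    then have "space (lik (snd p)) = space Y"
      by (auto simp: space_prob_algebra dest: sets_eq_imp_space_eq)
    then show "measure (lik (snd p)) (?A p) = (case p of (y, \<theta>) \<Rightarrow> exceed_prob d T (lik \<theta>) y)"
      by (simp add: exceed_prob_def split_beta)
  qed
  finally show ?thesis .
qed

text \<open>The posterior predictive is the mixture of the \<open>lik \<theta>\<close> over the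
  posterior. With y fixed the event is fixed too, so its mass under the mixture is the posterior
  average of its masses.\<close>

lemma joint_p_eq_nn_integral:
  assumes lik: "lik \<in> \<Theta> \<rightarrow>\<^sub>M prob_algebra Y"
    and T: "\<And>i. i \<in> {1..d} \<Longrightarrow> T i \<in> borel_measurable Y"
    and post: "post y \<in> space (prob_algebra \<Theta>)"
  shows "ennreal (joint_p d T lik post y) = (\<integral>\<^sup>+\<theta>. ennreal (exceed_prob d T (lik \<theta>) y) \<partial>post y)"
proof -
  let ?A = "{yrep \<in> space Y. \<forall>i\<in>{1..d}. T i yrep > T i y}"
  have sets [measurable_cong]: "sets (post y) = sets \<Theta>" and "prob_space (post y)"
    using post by (auto simp: space_prob_algebra)
  then have ne: "space (post y) \<noteq> {}" using prob_space.not_empty by blast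
  have [measurable]: "lik \<in> \<Theta> \<rightarrow>\<^sub>M subprob_algebra Y"
    using lik by (rule measurable_prob_algebraD)
  have lik': "lik \<in> post y \<rightarrow>\<^sub>M subprob_algebra Y" by measurable
  have sp: "space (lik \<theta>) = space Y" "prob_space (lik \<theta>)" if "\<theta> \<in> space (post y)" for \<theta>
  proof -
    have "lik \<theta> \<in> space (prob_algebra Y)"
      using measurable_space[OF lik] that sets_eq_imp_space_eq[OF sets] by simp
    then show "space (lik \<theta>) = space Y" "prob_space (lik \<theta>)"
      by (auto simp: space_prob_algebra dest: sets_eq_imp_space_eq)
  qed
  \<comment> \<open>The event in \<open>exceed_prob\<close> is cut out of the space of the mixture.
    Here \<open>ne\<close> rules out the default value of \<open>bind\<close> over an empty
    space.\<close>
  have spb: "space (post y \<bind> lik) = space Y"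
    using sp by (intro space_bind) (auto simp: ne intro!: sets_kernel[OF lik'])
  interpret B: subprob_space "post y \<bind> lik"
    by (rule subprob_space_bind[OF _ lik'])
      (use \<open>prob_space (post y)\<close> in \<open>simp add: prob_space_imp_subprob_space\<close>)
  have "ennreal (joint_p d T lik post y) = emeasure (post y \<bind> lik) ?A"
    by (simp add: joint_p_def posterior_predictive_def exceed_prob_def spb B.emeasure_eq_measure)
  also have "\<dots> = (\<integral>\<^sup>+\<theta>. emeasure (lik \<theta>) ?A \<partial>post y)"
    by (rule emeasure_bind[OF ne lik' sets_exceed[OF T]])
  also have "\<dots> = (\<integral>\<^sup>+\<theta>. ennreal (exceed_prob d T (lik \<theta>) y) \<partial>post y)"
  proof (rule nn_integral_cong)
    fix \<theta> assume \<theta>: "\<theta> \<in> space (post y)"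
    interpret L: prob_space "lik \<theta>" by (rule sp(2)[OF \<theta>])
    show "emeasure (lik \<theta>) ?A = ennreal (exceed_prob d T (lik \<theta>) y)"
      by (simp add: exceed_prob_def sp(1)[OF \<theta>] L.emeasure_eq_measure)
  qed
  finally show ?thesis .
qed

lemma joint_dist_in_prob_algebra:
  assumes prior: "prior \<in> space (prob_algebra \<Theta>)"
    and lik: "lik \<in> \<Theta> \<rightarrow>\<^sub>M prob_algebra Y"
  shows "joint_dist \<Theta> Y prior lik \<in> space (prob_algebra (Y \<Otimes>\<^sub>M \<Theta>))"
proof -
  have "(\<lambda>\<theta>. distr (lik \<theta>) (Y \<Otimes>\<^sub>M \<Theta>) (\<lambda>y. (y, \<theta>))) \<in> \<Theta> \<rightarrow>\<^sub>M prob_algebra (Y \<Otimes>\<^sub>M \<Theta>)"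
    by (rule measurable_distr_prob_space2[OF lik]) measurable
  then show ?thesis
    unfolding joint_dist_def
    using prior by (auto intro!: prob_space_bind' sets_bind' simp: space_prob_algebra)
qed

lemma prior_predictive_in_prob_algebra:
  assumes "prior \<in> space (prob_algebra \<Theta>)"
    and "lik \<in> \<Theta> \<rightarrow>\<^sub>M prob_algebra Y"
  shows "prior_predictive prior lik \<in> space (prob_algebra Y)"
  unfolding prior_predictive_def
  using assms by (auto intro!: prob_space_bind' sets_bind' simp: space_prob_algebra)

text \<open>Disintegration of the joint law. \<open>is_posterior\<close> fixes that law on
  rectangles only; since rectangles form an intersection-stable generator, it equals the law of
  drawing y from the prior predictive and then \<theta> from \<open>post y\<close>.\<close>

lemma nn_integral_joint_dist:
  assumes prior: "prior \<in> space (prob_algebra \<Theta>)"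
    and lik: "lik \<in> \<Theta> \<rightarrow>\<^sub>M prob_algebra Y"
    and post: "is_posterior \<Theta> Y prior lik post"
    and f [measurable]: "f \<in> borel_measurable (Y \<Otimes>\<^sub>M \<Theta>)"
  shows "(\<integral>\<^sup>+p. f p \<partial>joint_dist \<Theta> Y prior lik)
    = (\<integral>\<^sup>+y. \<integral>\<^sup>+\<theta>. f (y, \<theta>) \<partial>post y \<partial>prior_predictive prior lik)"
proof -
  let ?J = "joint_dist \<Theta> Y prior lik" and ?P = "prior_predictive prior lik"
  let ?k = "\<lambda>y. distr (post y) (Y \<Otimes>\<^sub>M \<Theta>) (\<lambda>\<theta>. (y, \<theta>))"
  let ?G = "{A \<times> B |A B. A \<in> sets Y \<and> B \<in> sets \<Theta>}"
  have J: "sets ?J = sets (Y \<Otimes>\<^sub>M \<Theta>)" "prob_space ?J"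
    using joint_dist_in_prob_algebra[OF prior lik] by (auto simp: space_prob_algebra)
  have P [measurable_cong]: "sets ?P = sets Y" and "prob_space ?P"
    using prior_predictive_in_prob_algebra[OF prior lik] by (auto simp: space_prob_algebra)
  then have ne: "space ?P \<noteq> {}" using prob_space.not_empty by blast
  have post_meas: "post \<in> Y \<rightarrow>\<^sub>M prob_algebra \<Theta>"
    and post_eq: "\<And>A B. A \<in> sets Y \<Longrightarrow> B \<in> sets \<Theta> \<Longrightarrow>
      emeasure ?J (A \<times> B) = (\<integral>\<^sup>+y\<in>A. emeasure (post y) B \<partial>?P)"
    using post by (auto simp: is_posterior_def)
  have [measurable]: "post \<in> Y \<rightarrow>\<^sub>M subprob_algebra \<Theta>"
    using post_meas by (rule measurable_prob_algebraD)
  have k: "?k \<in> ?P \<rightarrow>\<^sub>M subprob_algebra (Y \<Otimes>\<^sub>M \<Theta>)"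
    by (rule measurable_distr2[where M = \<Theta>]) measurable
  have sets_post: "sets (post y) = sets \<Theta>" if "y \<in> space ?P" for y
    using measurable_space[OF post_meas] that sets_eq_imp_space_eq[OF P]
    by (auto simp: space_prob_algebra)
  have Pair: "(\<lambda>\<theta>. (y, \<theta>)) \<in> post y \<rightarrow>\<^sub>M Y \<Otimes>\<^sub>M \<Theta>" if "y \<in> space ?P" for y
    using that sets_eq_imp_space_eq[OF P]
    by (simp cong: measurable_cong_sets add: sets_post[OF that] measurable_Pair1')
  have "?J = ?P \<bind> ?k"
  proof (rule measure_eqI_generator_eq[where E = ?G and \<Omega> = "space Y \<times> space \<Theta>"
        and A = "\<lambda>_. space Y \<times> space \<Theta>"])
    show "Int_stable ?G" by (rule Int_stable_pair_measure_generator)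
    show "?G \<subseteq> Pow (space Y \<times> space \<Theta>)" by (rule pair_measure_closed)
    show "sets ?J = sigma_sets (space Y \<times> space \<Theta>) ?G"
      by (simp add: J(1) sets_pair_measure)
    show "sets (?P \<bind> ?k) = sigma_sets (space Y \<times> space \<Theta>) ?G"
      by (subst sets_bind[of _ _ "Y \<Otimes>\<^sub>M \<Theta>"]) (auto simp: ne sets_pair_measure)
    show "range (\<lambda>_::nat. space Y \<times> space \<Theta>) \<subseteq> ?G" by auto
    show "(\<Union>i::nat. space Y \<times> space \<Theta>) = space Y \<times> space \<Theta>" by simp
    show "emeasure ?J (space Y \<times> space \<Theta>) \<noteq> \<infinity>"
      using J(2) by (simp add: prob_space_def finite_measure.emeasure_finite)
    fix X assume "X \<in> ?G"
    then obtain A B where X: "X = A \<times> B" and A [measurable]: "A \<in> sets Y"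
      and B [measurable]: "B \<in> sets \<Theta>" by blast
    have "emeasure (?P \<bind> ?k) X = (\<integral>\<^sup>+y. emeasure (?k y) (A \<times> B) \<partial>?P)"
      unfolding X by (rule emeasure_bind[OF ne k]) simp
    also have "\<dots> = (\<integral>\<^sup>+y\<in>A. emeasure (post y) B \<partial>?P)"
    proof (rule nn_integral_cong)
      fix y assume y: "y \<in> space ?P"
      \<comment> \<open>The section of a rectangle at y is B or empty, which produces the factor
        \<open>indicator A y\<close> of \<open>is_posterior\<close>.\<close>
      have "(\<lambda>\<theta>. (y, \<theta>)) -` (A \<times> B) \<inter> space (post y) = (if y \<in> A then B else {})"
        using sets.sets_into_space[OF B] sets_eq_imp_space_eq[OF sets_post[OF y]] by auto
      then show "emeasure (?k y) (A \<times> B) = emeasure (post y) B * indicator A y"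
        by (simp add: emeasure_distr[OF Pair[OF y]])
    qed
    finally show "emeasure ?J X = emeasure (?P \<bind> ?k) X"
      by (simp add: X post_eq)
  qed
  then have "(\<integral>\<^sup>+p. f p \<partial>?J) = (\<integral>\<^sup>+y. \<integral>\<^sup>+p. f p \<partial>?k y \<partial>?P)"
    by (simp add: nn_integral_bind[OF f k])
  also have "\<dots> = (\<integral>\<^sup>+y. \<integral>\<^sup>+\<theta>. f (y, \<theta>) \<partial>post y \<partial>?P)"
    by (intro nn_integral_cong nn_integral_distr Pair) simp_all
  finally show ?thesis .
qed

text \<open>\<open>ennreal\<close> sends negative reals to 0, so the left integrand is the positive
  part of s - X, that is, the length of the interval from X to s. Writing this length as an integral
  over t and swapping the integrals leaves the probability of X \<le> t.\<close>

lemma (in prob_space) nn_integral_diff_eq_integral_cdf: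
  assumes X [measurable]: "X \<in> borel_measurable M" and nonneg: "\<And>x. x \<in> space M \<Longrightarrow> 0 \<le> X x"
  shows "(\<integral>\<^sup>+x. ennreal (s - X x) \<partial>M) = ennreal (LBINT t:{0..s}. cdf (distr M borel X) t)"
proof -
  interpret D: real_distribution "distr M borel X"
    by (simp add: real_distribution_distr)
  have cdf_eq: "emeasure M {x \<in> space M. X x \<le> t} = ennreal (cdf (distr M borel X) t)" for t
    by (auto simp: cdf_def measure_distr emeasure_eq_measure intro!: arg_cong[where f = prob])
  have [measurable]: "cdf (distr M borel X) \<in> borel_measurable borel"
    by (intro borel_measurable_mono monoI D.cdf_nondecreasing)
  have "(\<integral>\<^sup>+x. ennreal (s - X x) \<partial>M)
      = (\<integral>\<^sup>+x. \<integral>\<^sup>+t. indicator {0..s} t * indicator {x \<in> space M. X x \<le> t} x \<partial>lborel \<partial>M)"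
  proof (rule nn_integral_cong)
    fix x assume x: "x \<in> space M"
    \<comment> \<open>As X x is nonnegative, the points t of [0, s] with X x \<le> t are exactly
      those of [X x, s], an empty interval if X x > s.\<close>
    have "(\<integral>\<^sup>+t. indicator {0..s} t * indicator {x \<in> space M. X x \<le> t} x \<partial>lborel)
        = (\<integral>\<^sup>+t. indicator {X x..s} t \<partial>lborel)"
      using x nonneg[OF x] by (intro nn_integral_cong) (auto split: split_indicator)
    also have "\<dots> = ennreal (s - X x)"
      by (cases "X x \<le> s") (auto simp: ennreal_neg)
    finally show "ennreal (s - X x)
      = (\<integral>\<^sup>+t. indicator {0..s} t * indicator {x \<in> space M. X x \<le> t} x \<partial>lborel)" ..
  qed
  also have "\<dots> = (\<integral>\<^sup>+t. \<integral>\<^sup>+x. indicator {0..s} t * indicator {x \<in> space M. X x \<le> t} x \<partial>M \<partial>lborel)"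
  proof -
    interpret pair_sigma_finite lborel M ..
    show ?thesis by (rule Fubini') measurable
  qed
  also have "\<dots> = (\<integral>\<^sup>+t. indicator {0..s} t * ennreal (cdf (distr M borel X) t) \<partial>lborel)"
    by (simp add: nn_integral_cmult cdf_eq)
  also have "\<dots> = (\<integral>\<^sup>+t. ennreal (indicator {0..s} t *\<^sub>R cdf (distr M borel X) t) \<partial>lborel)"
    by (intro nn_integral_cong) (auto split: split_indicator)
  also have "\<dots> = ennreal (LBINT t:{0..s}. cdf (distr M borel X) t)"
    unfolding set_lebesgue_integral_def
  proof (rule nn_integral_eq_integral)
    \<comment> \<open>A cdf is at most 1, so this indicator dominates the integrand.\<close>
    have "integrable lborel (indicator {0..s} :: real \<Rightarrow> real)"
      by (simp add: integrable_indicator_iff emeasure_lborel_Icc_eq)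
    then show "integrable lborel (\<lambda>t. indicator {0..s} t *\<^sub>R cdf (distr M borel X) t)"
      by (rule Bochner_Integration.integrable_bound)
        (auto split: split_indicator simp: D.cdf_nonneg D.cdf_bounded_prob)
  qed (auto split: split_indicator simp: D.cdf_nonneg)
  finally show ?thesis .
qed

theorem theorem1:
  fixes \<Theta> :: "'t measure" and Y :: "'y measure"
    and prior :: "'t measure" and lik :: "'t \<Rightarrow> 'y measure" and post :: "'y \<Rightarrow> 't measure"
    and d :: nat and T :: "nat \<Rightarrow> 'y \<Rightarrow> real" and \<alpha> :: real
  assumes "prior \<in> space (prob_algebra \<Theta>)"
    and "lik \<in> \<Theta> \<rightarrow>\<^sub>M prob_algebra Y"
    and "is_posterior \<Theta> Y prior lik post"
    and "\<And>i. i \<in> {1..d} \<Longrightarrow> T i \<in> borel_measurable Y"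
    and "\<alpha> \<in> {0..1}"
  shows "ereal (measure (prior_predictive prior lik)
             {y \<in> space (prior_predictive prior lik). joint_p d T lik post y \<le> \<alpha>})
         \<le> (INF s\<in>{\<alpha><..1}.
               ereal ((LBINT t:{0..s}. exceed_cdf \<Theta> Y prior lik d T t) / (s - \<alpha>)))"
\<comment> \<open>For \<alpha> = 1 the index set is empty and the infimum in \<open>ereal\<close> is
  +\<infinity>, so this case is covered as well.\<close>
proof (rule INF_greatest)
  fix s assume s: "s \<in> {\<alpha><..1}"
  let ?J = "joint_dist \<Theta> Y prior lik" and ?P = "prior_predictive prior lik"
  let ?g = "\<lambda>(y, \<theta>). exceed_prob d T (lik \<theta>) y"
  let ?u = "\<lambda>y. \<integral>\<^sup>+\<theta>. ennreal (s - ?g (y, \<theta>)) \<partial>post y"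
  let ?S = "{y \<in> space ?P. joint_p d T lik post y \<le> \<alpha>}"
  let ?I = "LBINT t:{0..s}. exceed_cdf \<Theta> Y prior lik d T t"
  have g [measurable]: "?g \<in> borel_measurable (Y \<Otimes>\<^sub>M \<Theta>)"
    by (rule measurable_exceed_prob[OF assms(2,4)])
  have J [measurable_cong]: "sets ?J = sets (Y \<Otimes>\<^sub>M \<Theta>)" and "prob_space ?J"
    using joint_dist_in_prob_algebra[OF assms(1,2)] by (auto simp: space_prob_algebra)
  have P [measurable_cong]: "sets ?P = sets Y" and "prob_space ?P"
    using prior_predictive_in_prob_algebra[OF assms(1,2)] by (auto simp: space_prob_algebra)
  interpret J: prob_space ?J by fact
  interpret P: prob_space ?P by fact
  have post: "post \<in> Y \<rightarrow>\<^sub>M prob_algebra \<Theta>"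
    using assms(3) by (simp add: is_posterior_def)
  have [measurable]: "post \<in> Y \<rightarrow>\<^sub>M subprob_algebra \<Theta>"
    using post by (rule measurable_prob_algebraD)
  have u [measurable]: "?u \<in> borel_measurable ?P"
    by (rule nn_integral_measurable_subprob_algebra2[where N = \<Theta>]) measurable
  have u_ge: "ennreal (s - \<alpha>) \<le> ?u y" if "y \<in> ?S" for y
  proof -
    from that have y: "y \<in> space Y" and le: "joint_p d T lik post y \<le> \<alpha>"
      using sets_eq_imp_space_eq[OF P] by auto
    have py: "post y \<in> space (prob_algebra \<Theta>)" by (rule measurable_space[OF post y])
    then have sets [measurable_cong]: "sets (post y) = sets \<Theta>" and "prob_space (post y)"
      by (auto simp: space_prob_algebra)
    interpret Q: prob_space "post y" by fact
    have [measurable]: "(\<lambda>\<theta>. ?g (y, \<theta>)) \<in> borel_measurable (post y)"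
      using measurable_compose[OF measurable_Pair1'[OF y] g]
      unfolding measurable_cong_sets[OF sets refl] .
    \<comment> \<open>The instance of Jensen's inequality is obtained by integrating s \<le> (s -
      g)^+ + g over the posterior, a probability measure.\<close>
    have "ennreal s = (\<integral>\<^sup>+\<theta>. ennreal s \<partial>post y)"
      by (simp add: Q.emeasure_space_1)
    also have "\<dots> \<le> (\<integral>\<^sup>+\<theta>. ennreal (s - ?g (y, \<theta>)) + ennreal (?g (y, \<theta>)) \<partial>post y)"
    proof (rule nn_integral_mono)
      fix \<theta>
      have "ennreal s = ennreal ((s - ?g (y, \<theta>)) + ?g (y, \<theta>))" by simp
      \<comment> \<open>Equality holds if g \<le> s; otherwise the truncated term is 0 and g alone
        exceeds s.\<close>
      also have "\<dots> \<le> ennreal (s - ?g (y, \<theta>)) + ennreal (?g (y, \<theta>))"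
        by (cases "s - ?g (y, \<theta>) \<ge> 0")
          (auto simp: exceed_prob_def ennreal_neg simp flip: ennreal_plus intro!: ennreal_leI)
      finally show "ennreal s \<le> ennreal (s - ?g (y, \<theta>)) + ennreal (?g (y, \<theta>))" .
    qed
    also have "\<dots> = ?u y + (\<integral>\<^sup>+\<theta>. ennreal (?g (y, \<theta>)) \<partial>post y)"
      by (rule nn_integral_add) measurable
    also have "(\<integral>\<^sup>+\<theta>. ennreal (?g (y, \<theta>)) \<partial>post y) = ennreal (joint_p d T lik post y)"
      unfolding prod.case
      by (rule joint_p_eq_nn_integral[symmetric, where post = post, OF assms(2) _ py]) (rule assms(4))
    also have "?u y + \<dots> \<le> ?u y + ennreal \<alpha>" by (intro add_left_mono ennreal_leI le)
    finally have "ennreal s - ennreal \<alpha> \<le> ?u y"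
      unfolding ennreal_minus_le_iff by (simp only: add.commute ennreal_neq_top simp_thms)
    \<comment> \<open>Merging the two terms into \<open>ennreal (s - \<alpha>)\<close> uses 0 \<le>
      \<alpha>.\<close>
    then show ?thesis
      using assms(5) by (simp only: ennreal_minus atLeastAtMost_iff)
  qed
  have U: "{y \<in> space ?P. ennreal (s - \<alpha>) \<le> ?u y} \<in> sets ?P"
    using u by (rule borel_measurable_le[OF borel_measurable_const])
  \<comment> \<open>Markov's inequality, applied to the superlevel set of \<open>?u\<close> that
    contains \<open>?S\<close>. Monotonicity asks for measurability of the larger set, which is
    \<open>U\<close>, so that of \<open>?S\<close> need not be shown.\<close>
  have "ennreal (s - \<alpha>) * emeasure ?P ?S
      \<le> ennreal (s - \<alpha>) * emeasure ?P {y \<in> space ?P. ennreal (s - \<alpha>) \<le> ?u y}"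
    using u_ge by (intro mult_left_mono emeasure_mono U subsetI CollectI conjI) simp_all
  also have "\<dots> = (\<integral>\<^sup>+y. ennreal (s - \<alpha>) * indicator {y \<in> space ?P. ennreal (s - \<alpha>) \<le> ?u y} y \<partial>?P)"
    by (rule nn_integral_cmult_indicator[symmetric, OF U])
  also have "\<dots> \<le> (\<integral>\<^sup>+y. ?u y \<partial>?P)"
    by (intro nn_integral_mono) (auto split: split_indicator)
  also have "\<dots> = (\<integral>\<^sup>+p. ennreal (s - ?g p) \<partial>?J)"
    by (rule nn_integral_joint_dist[OF assms(1-3), symmetric]) measurable
  also have "\<dots> = ennreal ?I"
    unfolding exceed_cdf_def
    by (rule J.nn_integral_diff_eq_integral_cdf) (measurable, auto simp: exceed_prob_def)
  finally have "ennreal ((s - \<alpha>) * measure ?P ?S) \<le> ennreal ?I"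
    using s by (simp add: P.emeasure_eq_measure ennreal_mult)
  \<comment> \<open>Since \<open>ennreal\<close> truncates, the inequality returns to the reals only
    once its right side is known to be nonnegative.\<close>
  moreover have "0 \<le> ?I"
    unfolding exceed_cdf_def cdf_def set_lebesgue_integral_def
    by (intro integral_nonneg_AE) auto
  ultimately have "(s - \<alpha>) * measure ?P ?S \<le> ?I"
    by simp
  then show "ereal (measure ?P ?S) \<le> ereal (?I / (s - \<alpha>))"
    using s by (simp add: pos_le_divide_eq mult.commute)
qed

end
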